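(* Let $g=(g_1,\ldots,g_n)^T:\mathbb{R}^n\to\mathbb{R}^n$ be continuously differentiable with $g(0)=0$, and consider the autonomous system $x'(t)=g(x)$, $x(t_0)=x_0$. For $i,j=1,\ldots,n$ and $x\in\mathbb{R}^n$ let $$d_{ij}(x)=\int_0^1 \frac{\partial g_i}{\partial x_j}(s x)\,ds ,$$ and let $$\beta_i(x)=d_{ii}(x)+\frac12\sum_{\substack{j=1\\ j\neq i}}^{n}\bigl(|d_{ij}(x)|+|d_{ji}(x)|\bigr).$$ Define $D=\{x\in\mathbb{R}^n:\|x\|\le M\}$ for some $M>0$, and assume that the functions $x\mapsto d_{ij}(x)\,x_i$ are continuous on $\mathbb{R}^n$ for all $i,j=1,\ldots,n$ with $i\neq j$. Then the zero solution of $x'(t)=g(x)$ is (a) stable if $-\infty<\beta_i(x)\le 0$ for $i=1,\ldots,n$ and all $x\in D$; (b) asymptotically stable if $-\infty<\beta_i(x)<0$ for $i=1,\ldots,n$ and all $x\in D$; (c) globally asymptotically stable if $-\infty<\beta_i(x)<0$ for $i=1,\ldots,n$ and all $x\in\mathbb{R}^n$.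
   Context: Here $x=(x_1,\ldots,x_n)^T$, and $\|\cdot\|$ is the Euclidean norm on $\mathbb{R}^n$. Throughout, $g$ is assumed smooth enough to guarantee existence, uniqueness and continuous dependence of solutions $x(t)=x(t;x_0)$. The entry $d_{ij}(x)$ is the integral over $s\in[0,1]$ of the $(i,j)$ entry of the Jacobian matrix of $g$ evaluated at $sx$; with $\mathbf{D}(x)=[d_{ij}(x)]_{n\times n}$ one has $g(x)=\mathbf{D}(x)x$. Since $g(0)=0$, the constant function $x(t)\equiv 0$ is a solution, called the zero solution. Stability, asymptotic stability and global asymptotic stability are in the usual sense of Lyapunov. *)

theory Defs
  imports "HOL-Analysis.Analysis"
begin

definition jacobian :: "(real^'n \<Rightarrow> real^'n) \<Rightarrow> real^'n \<Rightarrow> real^'n^'n" where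
  "jacobian g x = matrix (frechet_derivative g (at x))"

definition continuously_differentiable :: "(real^'n \<Rightarrow> real^'n) \<Rightarrow> bool" where
  "continuously_differentiable g \<longleftrightarrow>
     (\<forall>x. g differentiable (at x)) \<and> continuous_on UNIV (jacobian g)"

definition d :: "(real^'n \<Rightarrow> real^'n) \<Rightarrow> 'n \<Rightarrow> 'n \<Rightarrow> real^'n \<Rightarrow> real" where
  "d g i j x = integral {0..1} (\<lambda>s. jacobian g (s *\<^sub>R x) $ i $ j)"

definition beta :: "(real^'n \<Rightarrow> real^'n) \<Rightarrow> 'n \<Rightarrow> real^'n \<Rightarrow> real" where
  "beta g i x = d g i i x + 1/2 * (\<Sum>j\<in>UNIV - {i}. \<bar>d g i j x\<bar> + \<bar>d g j i x\<bar>)"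

(* At the left endpoint t0 the derivative is one-sided. *)
definition is_solution ::
  "(real^'n \<Rightarrow> real^'n) \<Rightarrow> real \<Rightarrow> real^'n \<Rightarrow> (real \<Rightarrow> real^'n) \<Rightarrow> bool" where
  "is_solution g t0 x0 x \<longleftrightarrow>
     x t0 = x0 \<and> (\<forall>t\<ge>t0. (x has_vector_derivative g (x t)) (at t within {t0..}))"

(* Lyapunov stability of the zero solution. Existence of the solution on the whole of
   [t0, infinity) is part of each notion, so that none of them can hold merely because
   solutions escape in finite time. For continuously differentiable g the solution is
   unique, so every solution on a shorter interval is a restriction of the global one. *)
definition zero_stable :: "(real^'n \<Rightarrow> real^'n) \<Rightarrow> real \<Rightarrow> bool" where
  "zero_stable g t0 \<longleftrightarrow>
     (\<forall>\<epsilon>>0. \<exists>\<delta>>0. \<forall>x0. norm x0 < \<delta> \<longrightarrow>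
        (\<exists>x. is_solution g t0 x0 x) \<and>
        (\<forall>x. is_solution g t0 x0 x \<longrightarrow> (\<forall>t\<ge>t0. norm (x t) < \<epsilon>)))"

definition attracted_to_zero :: "(real^'n \<Rightarrow> real^'n) \<Rightarrow> real \<Rightarrow> real^'n \<Rightarrow> bool" where
  "attracted_to_zero g t0 x0 \<longleftrightarrow>
     (\<exists>x. is_solution g t0 x0 x) \<and>
     (\<forall>x. is_solution g t0 x0 x \<longrightarrow> (x \<longlongrightarrow> 0) at_top)"

definition zero_asymptotically_stable :: "(real^'n \<Rightarrow> real^'n) \<Rightarrow> real \<Rightarrow> bool" where
  "zero_asymptotically_stable g t0 \<longleftrightarrow>
     zero_stable g t0 \<and> (\<exists>\<eta>>0. \<forall>x0. norm x0 < \<eta> \<longrightarrow> attracted_to_zero g t0 x0)"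

definition zero_globally_asymptotically_stable :: "(real^'n \<Rightarrow> real^'n) \<Rightarrow> real \<Rightarrow> bool" where
  "zero_globally_asymptotically_stable g t0 \<longleftrightarrow>
     zero_stable g t0 \<and> (\<forall>x0. attracted_to_zero g t0 x0)"

end

(* Writing g x = D(x) x and using 2 |a b| <= a^2 + b^2 on the off-diagonal terms gives
   x \<bullet> g x <= (\<Sum>i. beta_i(x) x_i^2), so |x|^2 is a Lyapunov function.  Solutions starting
   inside the ball D can therefore never leave it.  Global existence follows from the same remark:
   precomposing g with the projection onto D yields a globally Lipschitz field, whose solutions
   exist for all times and, staying in D, also solve the original equation.  If all beta_i are
   negative and |x|^2 had a positive limit, the trajectory would remain in a compact annulus on
   which x \<bullet> g x is bounded above by a negative constant, and |x|^2 would become negative. *)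

theory Submission
  imports Defs
begin

section \<open>Global solutions for Lipschitz fields\<close>

lemma integral_has_vector_derivative_atLeast:
  fixes \<phi> :: "real \<Rightarrow> 'a::banach"
  assumes "continuous_on {a..} \<phi>" "a \<le> t"
  shows "((\<lambda>u. integral {a..u} \<phi>) has_vector_derivative \<phi> t) (at t within {a..})"
proof -
  \<comment> \<open>Ending the interval at \<open>t + 1\<close> makes it agree with the half-line
    near \<open>t\<close>, even when \<open>t = a\<close>.\<close>
  have "((\<lambda>u. integral {a..u} \<phi>) has_vector_derivative \<phi> t) (at t within {a..t+1})"
    using assms by (intro integral_has_vector_derivative) (auto intro: continuous_on_subset)
  moreover have "at t within {a..t+1} = at t within {a..}"
    by (rule at_within_nhd[where S = "{t-1<..<t+1}"]) auto
  ultimately show ?thesis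
    by simp
qed

text \<open>Integrating the exponential bound gains a factor \<open>1 / K\<close> and the weight
  cancels the remaining growth, so the estimate is uniform in \<open>t\<close>. It yields both the
  boundedness of the weighted Picard iterates and the contraction factor.\<close>

lemma weighted_norm_integral_le:
  fixes \<phi> :: "real \<Rightarrow> 'a::banach"
  assumes "K > 0" "C \<ge> 0" "a \<le> t" "continuous_on {a..t} \<phi>"
    and bound: "\<And>s. s \<in> {a..t} \<Longrightarrow> norm (\<phi> s) \<le> C * exp (K * (s - a))"
  shows "exp (- (K * (t - a))) * norm (integral {a..t} \<phi>) \<le> C / K"
proof -
  have "((\<lambda>s. C * exp (K * (s - a))) has_integral
      C * exp (K * (t - a)) / K - C * exp (K * (a - a)) / K) {a..t}"
    using assms(1,3)
    by (intro fundamental_theorem_of_calculus)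
      (auto intro!: derivative_eq_intros simp flip: has_real_derivative_iff_has_vector_derivative)
  then have "norm (integral {a..t} \<phi>) \<le> C * exp (K * (t - a)) / K - C / K"
    using Henstock_Kurzweil_Integration.integral_norm_bound_integral
      [OF integrable_continuous_real[OF assms(4)] _ bound]
    by (auto simp: has_integral_iff)
  also have "\<dots> \<le> C * exp (K * (t - a)) / K"
    using assms by simp
  finally have "exp (- (K * (t - a))) * norm (integral {a..t} \<phi>)
      \<le> exp (- (K * (t - a))) * (C * exp (K * (t - a)) / K)"
    by (rule mult_left_mono) simp
  also have "\<dots> = C / K * (exp (- (K * (t - a))) * exp (K * (t - a)))"
    by simp
  also have "\<dots> = C / K"
    by (simp flip: exp_add)
  finally show ?thesis .
qed

(* Bielecki's weight exp (- 2 L (t - a)) makes the Picard operator a contraction on the whole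
   half-line; the fixed point is the weighted solution, extended constantly to the left of a. *)
lemma lipschitz_global_solution:
  fixes f :: "'a::banach \<Rightarrow> 'a"
  assumes L: "L-lipschitz_on UNIV f"
  obtains x where "x a = x0"
    "\<And>t. t \<ge> a \<Longrightarrow> (x has_vector_derivative f (x t)) (at t within {a..})"
proof -
  \<comment> \<open>Adding 1 makes the constant positive even if \<open>L = 0\<close>. Doubling it
    in \<open>K\<close> makes the contraction factor \<open>L' / K\<close> equal to 1/2.\<close>
  define L' where "L' = L + 1"
  have L': "L' > 0" "norm (f u - f v) \<le> L' * norm (u - v)" for u v
    using lipschitz_on_nonneg[OF L] lipschitz_onD[OF L, of u v]
      mult_right_mono[of L L' "norm (u - v)"]
    by (auto simp: L'_def dist_norm)
  define K where "K = 2 * L'"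
  have K: "K > 0"
    using L' by (simp add: K_def)
  have contf: "continuous_on UNIV f"
    by (rule lipschitz_on_continuous_on[OF L])
  \<comment> \<open>Clamping the time at \<open>a\<close> turns functions on the half-line into
    functions on all of the reals, as the complete space of bounded continuous functions
    requires.\<close>
  define m where "m = max a"
  have m: "m t \<ge> a" for t
    by (simp add: m_def)
  \<comment> \<open>Here \<open>y\<close> stands for the weighted unknown, so the factor
    \<open>exp (K * (s - a))\<close> restores the actual state. \<open>P\<close> is the Picard
    operator in actual terms, and \<open>T\<close> is its weighted version.\<close>
  define \<phi> where "\<phi> y s = f (exp (K * (s - a)) *\<^sub>R y s)" for y :: "real \<Rightarrow> 'a" and s
  define P where "P y t = x0 + integral {a..t} (\<phi> y)" for y t
  define T where "T y t = exp (- (K * (m t - a))) *\<^sub>R P y (m t)" for y t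
  have cont\<phi>: "continuous_on S (\<phi> y)" for S and y :: "real \<Rightarrow>\<^sub>C 'a"
    unfolding \<phi>_def by (intro continuous_on_compose2[OF contf] continuous_intros) auto
  have derP: "(P y has_vector_derivative \<phi> y t) (at t within {a..})"
    if "a \<le> t" for t and y :: "real \<Rightarrow>\<^sub>C 'a"
    unfolding P_def
    by (auto intro!: derivative_eq_intros integral_has_vector_derivative_atLeast cont\<phi> that)
  have contP: "continuous_on {a..} (P y)" for y :: "real \<Rightarrow>\<^sub>C 'a"
    using derP by (intro continuous_on_vector_derivative) auto
  have contT: "continuous_on UNIV (T y)" for y :: "real \<Rightarrow>\<^sub>C 'a"
    unfolding T_def m_def
    by (intro continuous_intros continuous_on_compose2[OF contP]) auto
  have "T y \<in> bcontfun" for y :: "real \<Rightarrow>\<^sub>C 'a"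
  proof -
    obtain B where B: "\<And>s. norm (y s) \<le> B"
      using bounded_apply_bcontfun[of y] by (auto simp: bounded_iff)
    have B0: "B \<ge> 0"
      using norm_ge_zero B by (rule order_trans)
    \<comment> \<open>A Lipschitz field grows at most linearly; since the exponential is at least 1
      for \<open>s \<ge> a\<close>, it also absorbs the constant \<open>norm (f 0)\<close>.\<close>
    define C where "C = norm (f 0) + L' * B"
    have C: "C \<ge> 0"
      using L' B0 by (simp add: C_def)
    have "norm (\<phi> y s) \<le> C * exp (K * (s - a))" if "s \<ge> a" for s
    proof -
      let ?e = "exp (K * (s - a))"
      have "norm (\<phi> y s) \<le> norm (f 0) + norm (f (?e *\<^sub>R y s) - f 0)"
        unfolding \<phi>_def by (rule norm_triangle_sub)
      also have "\<dots> \<le> norm (f 0) * 1 + L' * (?e * norm (y s))"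
        using L'(2)[of "?e *\<^sub>R y s" 0] by simp
      also have "\<dots> \<le> norm (f 0) * ?e + L' * (?e * B)"
        using L' B K that by (intro add_mono mult_left_mono) auto
      finally show ?thesis
        by (simp add: C_def algebra_simps)
    qed
    then have *: "exp (- (K * (t - a))) * norm (integral {a..t} (\<phi> y)) \<le> C / K" if "a \<le> t" for t
      using that K C by (intro weighted_norm_integral_le cont\<phi>) auto
    have "norm (T y t) \<le> norm x0 + C / K" for t
    proof -
      let ?e = "exp (- (K * (m t - a)))"
      have "norm (T y t) \<le> ?e * (norm x0 + norm (integral {a..m t} (\<phi> y)))"
        unfolding T_def P_def by (simp add: norm_triangle_ineq)
      also have "\<dots> \<le> norm x0 + C / K"
        unfolding distrib_left using K m[of t]
        by (intro add_mono *) (auto intro!: mult_left_le_one_le)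
      finally show ?thesis .
    qed
    then show ?thesis
      using contT by (auto simp: bcontfun_def bounded_iff)
  qed
  then have T: "apply_bcontfun (Bcontfun (T y)) = T y" for y :: "real \<Rightarrow>\<^sub>C 'a"
    by (rule Bcontfun_inverse)
  have "dist (Bcontfun (T y)) (Bcontfun (T z)) \<le> 1/2 * dist y z" for y z :: "real \<Rightarrow>\<^sub>C 'a"
  proof (rule dist_bound)
    fix t
    have "norm (\<phi> y s - \<phi> z s) \<le> L' * dist y z * exp (K * (s - a))" for s
    proof -
      have "norm (\<phi> y s - \<phi> z s) \<le> L' * (exp (K * (s - a)) * norm (y s - z s))"
        using L'(2)[of "exp (K * (s - a)) *\<^sub>R y s" "exp (K * (s - a)) *\<^sub>R z s"]
        by (simp add: \<phi>_def flip: scaleR_diff_right)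
      also have "\<dots> \<le> L' * (exp (K * (s - a)) * dist y z)"
        using L' dist_bounded[of y s z] by (simp add: dist_norm)
      finally show ?thesis
        by (simp add: algebra_simps)
    qed
    then have "exp (- (K * (m t - a))) * norm (integral {a..m t} (\<lambda>s. \<phi> y s - \<phi> z s))
        \<le> (L' * dist y z) / K"
      using K L' m by (intro weighted_norm_integral_le continuous_intros cont\<phi>) auto
    moreover have "integral {a..m t} (\<lambda>s. \<phi> y s - \<phi> z s) = P y (m t) - P z (m t)"
      by (simp add: P_def integral_diff integrable_continuous_real cont\<phi>)
    ultimately show "dist (Bcontfun (T y) t) (Bcontfun (T z) t) \<le> 1/2 * dist y z"
      using L' by (simp add: T dist_norm T_def K_def flip: scaleR_diff_right)
  qed
  then obtain y :: "real \<Rightarrow>\<^sub>C 'a" where y: "Bcontfun (T y) = y"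
    using banach_fix_type[of "1/2" "\<lambda>y. Bcontfun (T (apply_bcontfun y))"] by auto
  \<comment> \<open>Removing the weight from the fixed point equation shows that \<open>P y\<close>
    is the state at which \<open>\<phi> y\<close> evaluates \<open>f\<close>; hence
    \<open>P y\<close> is the solution.\<close>
  have fixed: "exp (K * (t - a)) *\<^sub>R y t = P y t" if "t \<ge> a" for t
  proof -
    have "y t = T y t"
      using T[of y] y by simp
    then show ?thesis
      using that by (simp add: T_def m_def max_def flip: exp_add)
  qed
  show thesis
  proof
    show "P y a = x0"
      by (simp add: P_def)
    show "(P y has_vector_derivative f (P y t)) (at t within {a..})" if "t \<ge> a" for t
      using derP[OF that, of y] fixed[OF that] by (simp add: \<phi>_def)
  qed
qed

section \<open>Continuously differentiable fields\<close>

lemma continuously_differentiable_imp_has_derivative: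
  assumes "continuously_differentiable g"
  shows "(g has_derivative (*v) (jacobian g x)) (at x)"
  using assms frechet_derivative_works[of g "at x"]
  by (simp add: continuously_differentiable_def jacobian_def has_derivative_linear)

lemma continuous_on_jacobian:
  "continuously_differentiable g \<Longrightarrow> continuous_on S (jacobian g)"
  unfolding continuously_differentiable_def by (blast intro: continuous_on_subset)

lemma continuously_differentiable_imp_continuous_on:
  "continuously_differentiable g \<Longrightarrow> continuous_on S g"
  by (meson continuously_differentiable_imp_has_derivative continuous_at_imp_continuous_on
      has_derivative_continuous)

text \<open>Compactness bounds the entries of the Jacobian, hence its operator norm, and convexity
  permits the mean value inequality along segments.\<close>

lemma continuously_differentiable_imp_lipschitz_on:
  fixes g :: "real^'n \<Rightarrow> real^'n"
  assumes g: "continuously_differentiable g" and S: "compact S" "convex S"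
  obtains L where "L-lipschitz_on S g"
proof -
  have "bounded (jacobian g ` S)"
    by (intro compact_imp_bounded compact_continuous_image continuous_on_jacobian g S)
  then obtain B where B: "\<And>x. x \<in> S \<Longrightarrow> norm (jacobian g x) \<le> B" and B0: "B > 0"
    by (auto simp: bounded_pos)
  define L where "L = real CARD('n) * real CARD('n) * B"
  have onorm: "onorm ((*v) (jacobian g x)) \<le> L" if "x \<in> S" for x
    unfolding L_def
  proof (rule onorm_le_matrix_component)
    fix i j
    have "\<bar>jacobian g x $ i $ j\<bar> \<le> norm (jacobian g x $ i)"
      by (rule component_le_norm_cart)
    also have "\<dots> \<le> norm (jacobian g x)"
      by (rule Finite_Cartesian_Product.norm_nth_le)
    finally show "\<bar>jacobian g x $ i $ j\<bar> \<le> B"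
      using B[OF that] by simp
  qed
  have "L-lipschitz_on S g"
  proof (rule lipschitz_onI)
    show "dist (g x) (g y) \<le> L * dist x y" if "x \<in> S" "y \<in> S" for x y
      using differentiable_bound[OF S(2)
          has_derivative_at_withinI[OF continuously_differentiable_imp_has_derivative[OF g]]
          onorm that]
      by (simp add: dist_norm)
    show "0 \<le> L"
      using B0 by (simp add: L_def)
  qed
  then show thesis ..
qed

section \<open>The averaged Jacobian and the upper bound for \<open>x \<bullet> g x\<close>\<close>

lemma component_eq_sum_d:
  fixes g :: "real^'n \<Rightarrow> real^'n"
  assumes g: "continuously_differentiable g" and "g 0 = 0"
  shows "g x $ i = (\<Sum>j\<in>UNIV. d g i j x * x $ j)"
proof -
  \<comment> \<open>The field is differentiated along the ray from 0 to \<open>x\<close>;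
    integrating over \<open>{0..1}\<close> recovers \<open>g x\<close> because
    \<open>g 0 = 0\<close>.\<close>
  have "((\<lambda>s. g (s *\<^sub>R x)) has_vector_derivative jacobian g (s *\<^sub>R x) *v x) (at s within {0..1})" for s
  proof -
    have "((\<lambda>s. g (s *\<^sub>R x)) has_derivative (\<lambda>h. jacobian g (s *\<^sub>R x) *v (h *\<^sub>R x)))
        (at s within {0..1})"
      by (rule has_derivative_compose[OF _ continuously_differentiable_imp_has_derivative[OF g]])
        (auto intro!: derivative_eq_intros)
    then show ?thesis
      by (simp add: has_vector_derivative_def matrix_vector_mult_scaleR)
  qed
  from fundamental_theorem_of_calculus[OF _ this]
  have "((\<lambda>s. jacobian g (s *\<^sub>R x) *v x) has_integral g x) {0..1}"
    using \<open>g 0 = 0\<close> by simp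
  from has_integral_linear[OF this bounded_linear_vec_nth[of i]]
  have "((\<lambda>s. \<Sum>j\<in>UNIV. jacobian g (s *\<^sub>R x) $ i $ j * x $ j) has_integral g x $ i) {0..1}"
    by (simp add: o_def matrix_vector_mult_def)
  \<comment> \<open>Continuity of the Jacobian makes each entry integrable, so \<open>d\<close> is a
    genuine integral and not the default value 0.\<close>
  moreover have "((\<lambda>s. \<Sum>j\<in>UNIV. jacobian g (s *\<^sub>R x) $ i $ j * x $ j) has_integral
      (\<Sum>j\<in>UNIV. d g i j x * x $ j)) {0..1}"
    unfolding d_def
    by (intro has_integral_sum has_integral_mult_left integrable_integral
        integrable_continuous_real continuous_intros
        continuous_on_compose2[OF continuous_on_jacobian[OF g, of UNIV]]) auto
  ultimately show ?thesis
    by (rule has_integral_unique)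
qed

lemma inner_le_sum_beta:
  fixes g :: "real^'n \<Rightarrow> real^'n"
  assumes "continuously_differentiable g" "g 0 = 0"
  shows "x \<bullet> g x \<le> (\<Sum>i\<in>UNIV. beta g i x * (x $ i)\<^sup>2)"
proof -
  let ?d = "\<lambda>i j. d g i j x"
  have amgm: "x $ i * (?d i j * x $ j) \<le> 1/2 * \<bar>?d i j\<bar> * (x $ i)\<^sup>2 + 1/2 * \<bar>?d i j\<bar> * (x $ j)\<^sup>2"
    for i j
  proof -
    have "\<bar>x $ i * x $ j\<bar> \<le> ((x $ i)\<^sup>2 + (x $ j)\<^sup>2) / 2"
      using sum_squares_bound[of "\<bar>x $ i\<bar>" "\<bar>x $ j\<bar>"] by (simp add: abs_mult)
    then have "\<bar>?d i j\<bar> * \<bar>x $ i * x $ j\<bar> \<le> \<bar>?d i j\<bar> * (((x $ i)\<^sup>2 + (x $ j)\<^sup>2) / 2)"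
      by (rule mult_left_mono) simp
    moreover have "x $ i * (?d i j * x $ j) \<le> \<bar>?d i j\<bar> * \<bar>x $ i * x $ j\<bar>"
      by (metis abs_ge_self abs_mult mult.left_commute)
    ultimately show ?thesis
      by (simp add: field_simps)
  qed
  \<comment> \<open>Half of each \<open>\<bar>d g i j x\<bar>\<close> goes to the square of
    \<open>x $ j\<close>. Exchanging the indices charges it to \<open>x $ i\<close>, which produces
    the column entries in \<open>beta\<close>.\<close>
  have swap: "(\<Sum>i\<in>UNIV. \<Sum>j\<in>UNIV - {i}. \<bar>?d i j\<bar> * (x $ j)\<^sup>2)
      = (\<Sum>i\<in>UNIV. \<Sum>j\<in>UNIV - {i}. \<bar>?d j i\<bar> * (x $ i)\<^sup>2)"
    by (simp add: sum_diff1 sum_subtractf, rule sum.swap)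
  have "x \<bullet> g x = (\<Sum>i\<in>UNIV. \<Sum>j\<in>UNIV. x $ i * (?d i j * x $ j))"
    by (simp add: inner_vec_def component_eq_sum_d[OF assms] sum_distrib_left)
  also have "\<dots> = (\<Sum>i\<in>UNIV. ?d i i * (x $ i)\<^sup>2 + (\<Sum>j\<in>UNIV - {i}. x $ i * (?d i j * x $ j)))"
    by (intro sum.cong refl, subst sum.remove[OF finite UNIV_I])
      (simp add: power2_eq_square algebra_simps)
  also have "\<dots> \<le> (\<Sum>i\<in>UNIV. ?d i i * (x $ i)\<^sup>2
      + (\<Sum>j\<in>UNIV - {i}. 1/2 * \<bar>?d i j\<bar> * (x $ i)\<^sup>2 + 1/2 * \<bar>?d i j\<bar> * (x $ j)\<^sup>2))"
    by (intro sum_mono add_left_mono amgm)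
  also have "\<dots> = (\<Sum>i\<in>UNIV. ?d i i * (x $ i)\<^sup>2)
      + 1/2 * (\<Sum>i\<in>UNIV. \<Sum>j\<in>UNIV - {i}. \<bar>?d i j\<bar> * (x $ i)\<^sup>2)
      + 1/2 * (\<Sum>i\<in>UNIV. \<Sum>j\<in>UNIV - {i}. \<bar>?d i j\<bar> * (x $ j)\<^sup>2)"
    by (simp add: sum.distrib sum_distrib_left mult.assoc)
  also have "\<dots> = (\<Sum>i\<in>UNIV. beta g i x * (x $ i)\<^sup>2)"
    unfolding swap beta_def
    by (simp add: sum.distrib sum_distrib_left sum_distrib_right algebra_simps)
  finally show ?thesis .
qed

lemma inner_nonpos:
  fixes g :: "real^'n \<Rightarrow> real^'n"
  assumes "continuously_differentiable g" "g 0 = 0" "\<And>i. beta g i x \<le> 0"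
  shows "x \<bullet> g x \<le> 0"
  using inner_le_sum_beta[OF assms(1,2), of x] assms(3)
  by (smt (verit, best) mult_nonneg_nonpos2 sum_nonpos zero_le_power2)

lemma inner_neg:
  fixes g :: "real^'n \<Rightarrow> real^'n"
  assumes "continuously_differentiable g" "g 0 = 0" "\<And>i. beta g i x < 0" "x \<noteq> 0"
  shows "x \<bullet> g x < 0"
proof -
  obtain i where i: "x $ i \<noteq> 0"
    using \<open>x \<noteq> 0\<close> by (auto simp: vec_eq_iff)
  have "(\<Sum>i\<in>UNIV. beta g i x * (x $ i)\<^sup>2) < (\<Sum>i\<in>(UNIV :: 'n set). 0)"
  \<comment> \<open>No summand is positive, and a nonzero component of \<open>x\<close> makes one of
    them negative.\<close>
  proof (rule sum_strict_mono_ex1)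
    show "\<forall>i\<in>UNIV. beta g i x * (x $ i)\<^sup>2 \<le> 0"
      using assms(3) by (simp add: mult_nonpos_nonneg less_imp_le)
    show "\<exists>i\<in>UNIV. beta g i x * (x $ i)\<^sup>2 < 0"
      using assms(3) i by (auto simp: mult_less_0_iff)
  qed simp
  then show ?thesis
    using inner_le_sum_beta[OF assms(1,2), of x] by simp
qed

section \<open>The Lyapunov function\<close>

lemma is_solution_continuous_on: "is_solution g t0 x0 x \<Longrightarrow> continuous_on {t0..} x"
  by (auto simp: is_solution_def intro: continuous_on_vector_derivative)

text \<open>Mean value theorem for the squared norm, whose derivative is
  \<open>2 * (x s \<bullet> g (x s))\<close>. The intermediate point is interior, so the bound is
  required only strictly between \<open>a\<close> and \<open>b\<close>; the exit-time argument
  relies on this.\<close>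

lemma is_solution_norm_decay:
  assumes sol: "is_solution g t0 x0 x" and ab: "t0 \<le> a" "a \<le> b"
    and decay: "\<And>s. a < s \<Longrightarrow> s < b \<Longrightarrow> x s \<bullet> g (x s) \<le> c"
  shows "(norm (x b))\<^sup>2 \<le> (norm (x a))\<^sup>2 + 2 * c * (b - a)"
proof (cases "a = b")
  case False
  have "((\<lambda>s. x s \<bullet> x s) has_derivative (\<lambda>h. h * (2 * (x s \<bullet> g (x s))))) (at s within {a..b})"
    if "a \<le> s" "s \<le> b" for s
  proof -
    have "(x has_vector_derivative g (x s)) (at s within {t0..})"
      using sol that ab by (auto simp: is_solution_def)
    then have "(x has_derivative (\<lambda>h. h *\<^sub>R g (x s))) (at s within {a..b})"
      unfolding has_vector_derivative_def
      by (rule has_derivative_subset) (use ab in auto)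
    from has_derivative_inner[OF this this] show ?thesis
      by (simp add: inner_commute algebra_simps)
  qed
  from mvt_simple[OF _ this] obtain s where "s \<in> {a<..<b}"
    "x b \<bullet> x b - x a \<bullet> x a = (b - a) * (2 * (x s \<bullet> g (x s)))"
    using False ab by auto
  moreover have "(b - a) * (2 * (x s \<bullet> g (x s))) \<le> (b - a) * (2 * c)"
    using decay[of s] calculation ab by (intro mult_left_mono) auto
  ultimately show ?thesis
    by (simp add: power2_norm_eq_inner algebra_simps)
qed simp

text \<open>At a first exit time the norm would be at least \<open>M\<close>. Up to then the
  solution lies in the ball, where the norm cannot grow, so it would still be at most
  \<open>norm x0 < M\<close>. Closedness of \<open>S\<close> ensures that the first exit time
  \<open>Inf S\<close> belongs to it.\<close>

lemma is_solution_stays_in_ball: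
  assumes sol: "is_solution g t0 x0 x" and x0: "norm x0 < M"
    and nonpos: "\<And>v. norm v \<le> M \<Longrightarrow> v \<bullet> g v \<le> 0" and t: "t0 \<le> t"
  shows "norm (x t) < M"
proof (rule ccontr)
  define S where "S = {t \<in> {t0..}. norm (x t) \<in> {M..}}"
  assume "\<not> norm (x t) < M"
  then have "t \<in> S"
    using t by (auto simp: S_def)
  moreover have "closed S"
    unfolding S_def
    by (intro continuous_closed_preimage[unfolded vimage_def Int_def mem_Collect_eq]
        continuous_intros is_solution_continuous_on[OF sol] closed_atLeast)
  moreover have bdd: "bdd_below S"
    by (rule bdd_belowI[of _ t0]) (auto simp: S_def)
  ultimately have "Inf S \<in> S"
    by (intro closed_contains_Inf) auto
  then have exit: "t0 \<le> Inf S" "M \<le> norm (x (Inf S))"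
    by (auto simp: S_def)
  have "(norm (x (Inf S)))\<^sup>2 \<le> (norm (x t0))\<^sup>2 + 2 * 0 * (Inf S - t0)"
  proof (rule is_solution_norm_decay[OF sol order_refl exit(1) nonpos])
    fix s
    assume "t0 < s" "s < Inf S"
    then show "norm (x s) \<le> M"
      using cInf_lower[OF _ bdd, of s] by (force simp: S_def)
  qed
  then have "norm (x (Inf S)) \<le> norm x0"
    using sol by (simp add: is_solution_def)
  then show False
    using exit x0 by simp
qed

lemma is_solution_norm_antimono:
  assumes sol: "is_solution g t0 x0 x" and x0: "norm x0 < M"
    and nonpos: "\<And>v. norm v \<le> M \<Longrightarrow> v \<bullet> g v \<le> 0" and ab: "t0 \<le> a" "a \<le> b"
  shows "norm (x b) \<le> norm (x a)"
proof -
  have "(norm (x b))\<^sup>2 \<le> (norm (x a))\<^sup>2 + 2 * 0 * (b - a)"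
    using is_solution_stays_in_ball[OF sol x0 nonpos] ab
    by (intro is_solution_norm_decay[OF sol ab nonpos]) (simp add: less_imp_le)
  then show ?thesis
    by simp
qed

lemma is_solution_exists:
  fixes g :: "real^'n \<Rightarrow> real^'n"
  assumes g: "continuously_differentiable g" and x0: "norm x0 < M"
    and nonpos: "\<And>v. norm v \<le> M \<Longrightarrow> v \<bullet> g v \<le> 0"
  shows "\<exists>x. is_solution g t0 x0 x"
proof -
  \<comment> \<open>The nearest-point projection onto a convex set is 1-Lipschitz, so
    \<open>g \<circ> p\<close> needs a Lipschitz constant of \<open>g\<close> on the ball
    only.\<close>
  define p where "p = closest_point (cball (0 :: real^'n) M)"
  have M: "M > 0"
    using norm_ge_zero x0 by (rule le_less_trans)
  have p: "p v = v" if "norm v \<le> M" for v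
    using that by (simp add: p_def closest_point_self)
  have "1-lipschitz_on UNIV p"
    using M by (intro lipschitz_onI) (auto simp: p_def intro!: closest_point_lipschitz)
  moreover obtain L where L: "L-lipschitz_on (cball 0 M) g"
    using continuously_differentiable_imp_lipschitz_on[OF g compact_cball convex_cball] .
  moreover have "range p \<subseteq> cball 0 M"
    using M by (auto simp: p_def simp del: mem_cball intro!: closest_point_in_set)
  ultimately have "(L * 1)-lipschitz_on UNIV (g \<circ> p)"
    by (intro lipschitz_on_compose) (auto intro: lipschitz_on_subset)
  then obtain x where x: "is_solution (g \<circ> p) t0 x0 x"
    unfolding is_solution_def by (rule lipschitz_global_solution) blast
  \<comment> \<open>The sign condition concerns only points of the ball, where \<open>p\<close> is
    the identity, so it carries over to \<open>g \<circ> p\<close>.\<close>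
  have "norm (x t) < M" if "t0 \<le> t" for t
    by (rule is_solution_stays_in_ball[OF x x0 _ that]) (simp add: p nonpos)
  then have "is_solution g t0 x0 x"
    using x by (simp add: is_solution_def p less_imp_le)
  then show ?thesis
    by blast
qed

lemma is_solution_tendsto_zero:
  fixes g :: "real^'n \<Rightarrow> real^'n"
  assumes g: "continuous_on UNIV g" and sol: "is_solution g t0 x0 x" and x0: "norm x0 < M"
    and neg: "\<And>v. norm v \<le> M \<Longrightarrow> v \<noteq> 0 \<Longrightarrow> v \<bullet> g v < 0"
  shows "(x \<longlongrightarrow> 0) at_top"
proof (rule ccontr)
  assume not_lim: "\<not> (x \<longlongrightarrow> 0) at_top"
  have nonpos: "v \<bullet> g v \<le> 0" if "norm v \<le> M" for v
    using neg[OF that] by (cases "v = 0") auto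
  obtain e where e: "e > 0" "\<not> (\<forall>\<^sub>F t in at_top. norm (x t) < e)"
    using not_lim by (auto simp: tendsto_iff)
  \<comment> \<open>The norm is nonincreasing: once below \<open>e\<close> it would stay there,
    contrary to the choice of \<open>e\<close>.\<close>
  have ge_e: "norm (x t) \<ge> e" if "t \<ge> t0" for t
  proof (rule ccontr)
    assume "\<not> norm (x t) \<ge> e"
    then have "\<forall>s\<ge>t. norm (x s) < e"
      using is_solution_norm_antimono[OF sol x0 nonpos that] by force
    with e show False
      by (auto simp: eventually_at_top_linorder)
  qed
  \<comment> \<open>The annulus contains the trajectory, hence is nonempty, and avoids 0, so the
    maximum of \<open>v \<bullet> g v\<close> on it is negative.\<close>
  define A :: "(real^'n) set" where "A = cball 0 M \<inter> {v. e \<le> norm v}"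
  have "compact A"
    unfolding A_def by (intro compact_Int_closed closed_Collect_le continuous_intros) auto
  moreover have inA: "x t \<in> A" if "t \<ge> t0" for t
    using ge_e[OF that] is_solution_stays_in_ball[OF sol x0 nonpos that] by (simp add: A_def)
  moreover have "continuous_on A (\<lambda>v. v \<bullet> g v)"
    by (intro continuous_intros continuous_on_subset[OF g]) auto
  ultimately obtain w where w: "w \<in> A" "\<And>v. v \<in> A \<Longrightarrow> v \<bullet> g v \<le> w \<bullet> g w"
    using continuous_attains_sup[of A "\<lambda>v. v \<bullet> g v"] by blast
  define c where "c = - (w \<bullet> g w)"
  have c: "c > 0"
    using neg[of w] w(1) e(1) by (cases "w = 0") (auto simp: A_def c_def)
  \<comment> \<open>The time at which the linear upper bound for the squared norm reaches 0,
    although the norm is still at least \<open>e > 0\<close>.\<close>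
  define b where "b = t0 + (norm x0)\<^sup>2 / (2 * c)"
  have b: "t0 \<le> b"
    using c by (simp add: b_def)
  have "(norm (x b))\<^sup>2 \<le> (norm (x t0))\<^sup>2 + 2 * (- c) * (b - t0)"
    using w(2) inA by (intro is_solution_norm_decay[OF sol order_refl b]) (simp add: c_def)
  also have "\<dots> = 0"
    using sol c by (simp add: is_solution_def b_def)
  finally show False
    using ge_e[OF b] e(1) by simp
qed

section \<open>Stability, attraction and the three conclusions\<close>

lemma zero_stableI:
  fixes g :: "real^'n \<Rightarrow> real^'n"
  assumes g: "continuously_differentiable g" and M: "M > 0"
    and nonpos: "\<And>v. norm v \<le> M \<Longrightarrow> v \<bullet> g v \<le> 0"
  shows "zero_stable g t0"
  unfolding zero_stable_def
proof (intro allI impI)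
  fix e :: real
  assume "e > 0"
  show "\<exists>\<delta>>0. \<forall>x0. norm x0 < \<delta> \<longrightarrow> (\<exists>x. is_solution g t0 x0 x) \<and>
      (\<forall>x. is_solution g t0 x0 x \<longrightarrow> (\<forall>t\<ge>t0. norm (x t) < e))"
  \<comment> \<open>The ball of radius \<open>min e M\<close> is itself never left, so this radius
    serves as \<delta>; the cap by \<open>M\<close> keeps it where the sign of
    \<open>v \<bullet> g v\<close> is known.\<close>
  proof (rule exI[of _ "min e M"], intro conjI allI impI)
    show "min e M > 0"
      using \<open>e > 0\<close> M by simp
  next
    fix x0 :: "real^'n"
    assume "norm x0 < min e M"
    then show "\<exists>x. is_solution g t0 x0 x"
      by (intro is_solution_exists[OF g _ nonpos]) auto
  next
    fix x0 :: "real^'n" and x t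
    assume "norm x0 < min e M" "is_solution g t0 x0 x" "t0 \<le> t"
    then have "norm (x t) < min e M"
      by (intro is_solution_stays_in_ball) (auto intro: nonpos)
    then show "norm (x t) < e"
      by simp
  qed
qed

lemma attracted_to_zeroI:
  fixes g :: "real^'n \<Rightarrow> real^'n"
  assumes g: "continuously_differentiable g" and x0: "norm x0 < M"
    and neg: "\<And>v. norm v \<le> M \<Longrightarrow> v \<noteq> 0 \<Longrightarrow> v \<bullet> g v < 0"
  shows "attracted_to_zero g t0 x0"
proof -
  have "v \<bullet> g v \<le> 0" if "norm v \<le> M" for v
    using neg[OF that] by (cases "v = 0") auto
  then show ?thesis
    unfolding attracted_to_zero_def
    using is_solution_exists[OF g x0] x0 neg
      is_solution_tendsto_zero[OF continuously_differentiable_imp_continuous_on[OF g]]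
    by blast
qed

theorem theorem5:
  fixes g :: "real^'n \<Rightarrow> real^'n" and t0 M :: real and D :: "(real^'n) set"
  assumes "continuously_differentiable g"
    and "g 0 = 0"
    and "M > 0"
    and "D = {x. norm x \<le> M}"
    and "\<And>i j. i \<noteq> j \<Longrightarrow> continuous_on UNIV (\<lambda>x. d g i j x * x $ i)"
  shows "((\<forall>i. \<forall>x\<in>D. beta g i x \<le> 0) \<longrightarrow> zero_stable g t0) \<and>
         ((\<forall>i. \<forall>x\<in>D. beta g i x < 0) \<longrightarrow> zero_asymptotically_stable g t0) \<and>
         ((\<forall>i x. beta g i x < 0) \<longrightarrow> zero_globally_asymptotically_stable g t0)"
proof -
  note g = assms(1,2)
  have stable: "zero_stable g t0" if "\<forall>i. \<forall>x\<in>D. beta g i x \<le> 0"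
    using that assms(4) by (intro zero_stableI[OF g(1) assms(3)] inner_nonpos[OF g]) auto
  \<comment> \<open>The radius is kept free: the local claim takes \<open>M\<close>, whereas the
    global one takes a ball around 0 large enough for the given \<open>x0\<close>.\<close>
  have attracted: "attracted_to_zero g t0 x0"
    if "\<forall>i x. norm x \<le> R \<longrightarrow> beta g i x < 0" "norm x0 < R" for R x0
    using that by (intro attracted_to_zeroI[OF g(1) that(2)] inner_neg[OF g]) auto
  have "zero_asymptotically_stable g t0" if "\<forall>i. \<forall>x\<in>D. beta g i x < 0"
    unfolding zero_asymptotically_stable_def
    using stable attracted[of M] that assms(3,4) by (auto intro: less_imp_le)
  moreover have "zero_globally_asymptotically_stable g t0" if "\<forall>i x. beta g i x < 0"
    unfolding zero_globally_asymptotically_stable_def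
  proof
    show "zero_stable g t0"
      using that by (intro stable) (auto intro: less_imp_le)
    show "\<forall>x0. attracted_to_zero g t0 x0"
    proof
      fix x0
      show "attracted_to_zero g t0 x0"
        using that by (intro attracted[of "norm x0 + 1"]) auto
    qed
  qed
  ultimately show ?thesis
    using stable by blast
qed

end
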